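(* Let $e\ge 4$, $q\ge 1$, $d\ge 1$ be integers, put $m=e+2q+1$ and assume $\gcd(m,d)=1$. Let $\Gamma=\Gamma_{(e,q,d)}(\mathcal S)$ be the numerical semigroup generated by $\mathcal S=\{m,\;m+d\}\cup\{(q+1)m+(q+i)d\mid 2\le i\le e-1\}$. Then the Apéry table $\mathrm{AT}(\Gamma,m)$ is an $m\times m$ matrix of the form $\begin{pmatrix}\mathcal S_1&\mathcal S_2&\mathcal S_3\end{pmatrix}$ (for the ordering of the Apéry set given by the first row of this matrix), where: $\bullet$ $\mathcal S_1=(s_{jk})_{m\times(q+2)}$ with $s_{1k}=(k-1)(m+d)$ for $1\le k\le q+2$; $s_{j1}=(j-1)m$ for $2\le j\le m$; and for $2\le k\le q+2$, $2\le j\le m$, $s_{jk}=(k-1)(m+d)+\delta_{jk}m$, where $\delta_{jk}=0$ if $j<k$ and $\delta_{jk}=j-k$ if $j\ge k$. $\bullet$ $\mathcal S_2=(s_{jk})_{m\times(q+2)}$ with $s_{1k}=(k-1)(m+d)+(q+1)m+(q+e-1)d$ for $1\le k\le q+2$, and for each $1\le k\le q+2$: $$s_{jk}=\begin{cases}s_{1k}, & 1\le j\le k+1;\\ s_{1k}+(j-k-1)m, & k+2\le j\le e+k-2;\\ s_{1k}+(e-2)m, & e+k-1\le j\le e+q+k-1;\\ s_{1k}+(j-q-k-1)m, & e+q+k\le j\le m.\end{cases}$$ $\bullet$ $\mathcal S_3=(s_{jk})_{m\times(e-3)}$ with $s_{1k}=(q+1)m+(q+k+1)d$ for $1\le k\le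 e-3$, and for each $1\le k\le e-3$: $$s_{jk}=\begin{cases}s_{1k}+(j-2)m, & 2\le j\le k+1;\\ s_{1k}+km, & k+2\le j\le q+k+2;\\ s_{1k}+(j-q-2)m, & q+k+3\le j\le m.\end{cases}$$
   Context: For a numerical semigroup $\Gamma$ with multiplicity (least positive element) $a_1$, the Apéry set is $\mathrm{Ap}(\Gamma,a_1)=\{s\in\Gamma\mid s-a_1\notin\Gamma\}=\{\omega_0=0,\omega_1,\dots,\omega_{a_1-1}\}$. Let $M=\Gamma\setminus\{0\}$ and $nM=M+\dots+M$ ($n$ copies), and let the reduction number be $r=\min\{r\mid (r+1)M=a_1+rM\}$. Define $\omega_{0,i}=\omega_i$, $\omega_{1,0}=a_1$, $\omega_{1,i}=\omega_i$ for $1\le i\le a_1-1$, and inductively for $n\ge 1$: $\omega_{n+1,i}=\omega_{n,i}$ if $\omega_{n,i}\in (n+1)M$, and $\omega_{n+1,i}=\omega_{n,i}+a_1$ otherwise. The Apéry table $\mathrm{AT}(\Gamma,a_1)$ is the $(r+1)\times a_1$ table whose row number $n$ ($0\le n\le r$) is $(\omega_{n,0},\dots,\omega_{n,a_1-1})$. In the matrix notation of the claim, rows are indexed from $1$, so matrix row $j$ is row $n=j-1$ of the table. *)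

theory Defs
  imports "Jordan_Normal_Form.Matrix" "HOL-Library.Set_Algebras"
begin

definition numerical_semigroup :: "nat set \<Rightarrow> bool" where
  "numerical_semigroup \<Gamma> \<longleftrightarrow>
     0 \<in> \<Gamma> \<and> (\<forall>x\<in>\<Gamma>. \<forall>y\<in>\<Gamma>. x + y \<in> \<Gamma>) \<and> finite (- \<Gamma>)"

definition semigroup_generated :: "nat set \<Rightarrow> nat set" where
  "semigroup_generated S = sum_list ` lists S"

definition multiplicity_of :: "nat set \<Rightarrow> nat" where
  "multiplicity_of \<Gamma> = (LEAST s. s \<in> \<Gamma> \<and> 0 < s)"

(* The subtraction takes place in the integers, hence the casts. *)
definition apery_set :: "nat set \<Rightarrow> nat \<Rightarrow> nat set" where
  "apery_set \<Gamma> a = {s \<in> \<Gamma>. int s - int a \<notin> int ` \<Gamma>}"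

(* n-fold Minkowski sum of the maximal ideal M = \<Gamma> - {0}; the empty sum is {0}. *)
definition fold_max_ideal :: "nat \<Rightarrow> nat set \<Rightarrow> nat set" where
  "fold_max_ideal n \<Gamma> = sum_list (replicate n (\<Gamma> - {0}))"

definition reduction_number :: "nat set \<Rightarrow> nat \<Rightarrow> nat" where
  "reduction_number \<Gamma> a =
     (LEAST r. fold_max_ideal (r + 1) \<Gamma> = a +o fold_max_ideal r \<Gamma>)"

definition apery_ordering :: "nat set \<Rightarrow> nat \<Rightarrow> (nat \<Rightarrow> nat) \<Rightarrow> bool" where
  "apery_ordering \<Gamma> a \<omega> \<longleftrightarrow> bij_betw \<omega> {..<a} (apery_set \<Gamma> a) \<and> \<omega> 0 = 0"

fun apery_entry :: "nat set \<Rightarrow> nat \<Rightarrow> (nat \<Rightarrow> nat) \<Rightarrow> nat \<Rightarrow> nat \<Rightarrow> nat" where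
  "apery_entry \<Gamma> a \<omega> 0 i = \<omega> i"
| "apery_entry \<Gamma> a \<omega> (Suc 0) i = (if i = 0 then a else \<omega> i)"
| "apery_entry \<Gamma> a \<omega> (Suc (Suc n)) i =
     (if apery_entry \<Gamma> a \<omega> (Suc n) i \<in> fold_max_ideal (Suc (Suc n)) \<Gamma>
      then apery_entry \<Gamma> a \<omega> (Suc n) i
      else apery_entry \<Gamma> a \<omega> (Suc n) i + a)"

definition apery_table :: "nat set \<Rightarrow> nat \<Rightarrow> (nat \<Rightarrow> nat) \<Rightarrow> nat mat" where
  "apery_table \<Gamma> a \<omega> =
     mat (reduction_number \<Gamma> a + 1) a (\<lambda>(n, i). apery_entry \<Gamma> a \<omega> n i)"

(* Matrix given by a formula in row and column indices j, k that start at 1. *)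
definition mat1 :: "nat \<Rightarrow> nat \<Rightarrow> (nat \<Rightarrow> nat \<Rightarrow> 'a) \<Rightarrow> 'a mat" where
  "mat1 nr nc f = mat nr nc (\<lambda>(j, k). f (j + 1) (k + 1))"

definition append_cols :: "'a :: zero mat \<Rightarrow> 'a mat \<Rightarrow> 'a mat" where
  "append_cols A B = four_block_mat A B (0\<^sub>m 0 (dim_col A)) (0\<^sub>m 0 (dim_col B))"

definition gens :: "nat \<Rightarrow> nat \<Rightarrow> nat \<Rightarrow> nat set" where
  "gens e q d = (let m = e + 2 * q + 1 in
     {m, m + d} \<union> {(q + 1) * m + (q + i) * d | i. 2 \<le> i \<and> i \<le> e - 1})"

(* In the three blocks every natural number subtraction is exact in the range of
   indices of its case. *)
definition S1 :: "nat \<Rightarrow> nat \<Rightarrow> nat \<Rightarrow> nat mat" where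
  "S1 e q d = (let m = e + 2 * q + 1 in
     mat1 m (q + 2) (\<lambda>j k.
       if j = 1 then (k - 1) * (m + d)
       else if k = 1 then (j - 1) * m
       else (k - 1) * (m + d) + (if j < k then 0 else j - k) * m))"

definition S2 :: "nat \<Rightarrow> nat \<Rightarrow> nat \<Rightarrow> nat mat" where
  "S2 e q d = (let m = e + 2 * q + 1 in
     mat1 m (q + 2) (\<lambda>j k.
       let s = (k - 1) * (m + d) + (q + 1) * m + (q + e - 1) * d in
       if j \<le> k + 1 then s
       else if j \<le> e + k - 2 then s + (j - k - 1) * m
       else if j \<le> e + q + k - 1 then s + (e - 2) * m
       else s + (j - q - k - 1) * m))"

definition S3 :: "nat \<Rightarrow> nat \<Rightarrow> nat \<Rightarrow> nat mat" where
  "S3 e q d = (let m = e + 2 * q + 1 in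
     mat1 m (e - 3) (\<lambda>j k.
       let s = (q + 1) * m + (q + k + 1) * d in
       if j = 1 then s
       else if j \<le> k + 1 then s + (j - 2) * m
       else if j \<le> q + k + 2 then s + k * m
       else s + (j - q - 2) * m))"

end

theory Submission
  imports Defs "HOL-Number_Theory.Cong"
begin

text \<open>
  Every generator is a nonnegative integer combination \<open>x * m + y * d\<close>: the pairs \<open>(x, y)\<close> are
  \<open>(1, 0)\<close>, \<open>(1, 1)\<close> and the big ones \<open>(q + 1, q + i)\<close>.  Since \<open>m\<close> and \<open>d\<close> are coprime, every number
  has at most one such expression with \<open>y < m\<close>, and \<open>y\<close> then names its residue class modulo \<open>m\<close>.
  The set of sums of at least \<open>n\<close> generators is closed under adding \<open>m\<close>, so within a residue class
  it is the set of all \<open>x * m + y * d\<close> with \<open>x\<close> above a threshold, and everything reduces to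
  computing this threshold.

  A sum of \<open>N\<close> generators with \<open>c\<close> big ones has \<open>x = N + c * q\<close>.  If \<open>c = 0\<close> then \<open>y \<le> x\<close>; if
  \<open>c = 1\<close> then \<open>y\<close> is at most \<open>e - 2 + x\<close>; and if \<open>c \<ge> 2\<close> then \<open>x\<close> is at least \<open>2 * q + 2\<close>, which is
  so large that nothing new is reached for \<open>y < m\<close>.  Conversely, no big generator or a single one
  already reaches every pair allowed by these bounds.  The threshold is therefore
  \<open>max n (min y (q + max n (max 1 (y + 2 - (q + e)))))\<close>: either there is no big generator and
  \<open>x \<ge> y\<close>, or there is one and \<open>x \<ge> q + n\<close>, \<open>x \<ge> q + 1\<close>, \<open>x \<ge> y + 2 - e\<close>.  This is the content of
  \<open>sums_of_many_gens\<close>.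

  The rest follows by reading off.  The thresholds for \<open>n = 0\<close> give the Apery set.  The recursion
  for the table replaces an entry by the next element of its residue class exactly when the
  threshold moves, and the threshold grows by at most one per row, so every entry of the table sits
  at the threshold.  Finally, for \<open>r \<ge> 1\<close>, \<open>(r + 1)M = m + rM\<close> means that all thresholds grow by one from
  \<open>r\<close> to \<open>r + 1\<close>; this fails in the class \<open>y = r + 1\<close> as long as \<open>r + 1 < m\<close>, and holds for
  \<open>r = m - 1\<close>.  For \<open>r = 0\<close> it fails because \<open>M\<close> has more than one element.  So the reduction number is \<open>m - 1\<close>, and the table has \<open>m\<close> rows.
\<close>

section \<open>Powers of the maximal ideal\<close>

definition long_sums :: "nat set \<Rightarrow> nat \<Rightarrow> nat set" where
  "long_sums S n = {sum_list xs | xs. xs \<in> lists S \<and> n \<le> length xs}"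

lemma long_sums_0: "long_sums S 0 = semigroup_generated S"
  by (auto simp: long_sums_def semigroup_generated_def)

lemma semigroup_generated_minus_zero:
  assumes "0 \<notin> S"
  shows "semigroup_generated S - {0} = long_sums S 1"
proof -
  have "sum_list xs = 0 \<longleftrightarrow> xs = []" if "xs \<in> lists S" for xs
    using that assms by (cases xs) auto
  then show ?thesis
    by (auto simp: long_sums_def semigroup_generated_def Suc_le_eq) blast
qed

text \<open>
  An element of \<open>nM\<close> is a sum of \<open>n\<close> nonempty sums of generators, and a list of at least \<open>n\<close>
  generators can be cut into \<open>n\<close> nonempty pieces.  The case \<open>n = 0\<close> is different because the
  empty Minkowski sum is \<open>{0}\<close> and not the whole semigroup.
\<close>

lemma fold_max_ideal_eq_long_sums:
  assumes "0 \<notin> S" and "n \<ge> 1"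
  shows "fold_max_ideal n (semigroup_generated S) = long_sums S n"
  using assms(2)
proof (induction n rule: dec_induct)
  case base
  show ?case
    using semigroup_generated_minus_zero[OF assms(1)] by (simp add: fold_max_ideal_def)
next
  case (step n)
  have "fold_max_ideal (Suc n) (semigroup_generated S) = long_sums S 1 + long_sums S n"
    using step.IH semigroup_generated_minus_zero[OF assms(1)] by (simp add: fold_max_ideal_def)
  also have "\<dots> = long_sums S (Suc n)"
  proof (intro equalityI subsetI)
    fix s assume "s \<in> long_sums S 1 + long_sums S n"
    then obtain xs ys where "s = sum_list (xs @ ys)" "xs @ ys \<in> lists S" "Suc n \<le> length (xs @ ys)"
      by (fastforce simp: set_plus_def long_sums_def)
    then show "s \<in> long_sums S (Suc n)"
      unfolding long_sums_def by blast
  next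
    fix s assume "s \<in> long_sums S (Suc n)"
    then obtain xs where xs: "s = sum_list xs" "xs \<in> lists S" "Suc n \<le> length xs"
      by (auto simp: long_sums_def)
    then obtain x ys where x: "xs = x # ys" by (cases xs) auto
    have "sum_list [x] \<in> long_sums S 1" "sum_list ys \<in> long_sums S n"
      unfolding long_sums_def using xs x by fastforce+
    then have "sum_list [x] + sum_list ys \<in> long_sums S 1 + long_sums S n"
      by (rule set_plus_intro)
    then show "s \<in> long_sums S 1 + long_sums S n"
      using xs x by simp
  qed
  finally show ?case .
qed

section \<open>Coordinates modulo the multiplicity\<close>

lemma coordinates_unique:
  fixes m d :: nat
  assumes "coprime m d" and "y < m" and "y' < m" and "x * m + y * d = x' * m + y' * d"
  shows "x = x' \<and> y = y'"
proof -
  have "[x * m + y * d = x' * m + y' * d] (mod m)"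
    using assms(4) by simp
  then have "[y * d = y' * d] (mod m)"
    by (simp add: cong_def)
  then have "y = y'"
    using assms(1-3) by (metis cong_mult_rcancel_nat cong_less_modulus_unique_nat coprime_commute)
  with assms show ?thesis by simp
qed

lemma coordinates_exist:
  fixes m d s :: nat
  assumes "coprime m d" and "m > 0" and "s \<ge> k * m + m * d"
  obtains x y where "s = x * m + y * d" "y < m" "x \<ge> k"
proof -
  obtain w where "[d * w = Suc 0] (mod m)"
    using cong_solve_coprime_nat[of d m] assms(1) by (auto simp: coprime_commute)
  then have z: "[d * (w * s) = s] (mod m)"
    using cong_scalar_right[of "d * w" "Suc 0" m s] by (simp add: mult.assoc)
  define y where "y = (w * s) mod m"
  have y: "y < m" using assms(2) by (simp add: y_def)
  have c: "[y * d = s] (mod m)"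
    using z by (simp add: y_def cong_def mod_mult_left_eq mult.commute mod_mult_right_eq)
  have "y * d \<le> m * d" using y by simp
  then have le: "k * m + y * d \<le> s" using assms(3) by linarith
  then have "m dvd s - y * d"
    using c by (metis add_leD2 cong_sym cong_altdef_nat)
  then obtain x where x: "s - y * d = m * x" by (elim dvdE)
  have s: "s = x * m + y * d" using x le by (simp add: mult.commute)
  then have "k * m \<le> x * m" using le by simp
  then have "k \<le> x" using assms(2) by simp
  with s y that show thesis by blast
qed

section \<open>The thresholds\<close>

text \<open>
  The least \<open>x\<close> such that \<open>x * m + y * d\<close>, for \<open>y < m\<close>, is a sum of at least \<open>n\<close> generators.  The
  inner minimum compares using no big generator with using one; a truncated difference
  \<open>y + 2 - (q + e) = 0\<close> means that \<open>y\<close> is small enough not to require any copy of \<open>m + d\<close> next to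
  a big generator.
\<close>

definition threshold :: "nat \<Rightarrow> nat \<Rightarrow> nat \<Rightarrow> nat \<Rightarrow> nat" where
  "threshold e q n y = max n (min y (q + max n (max 1 (y + 2 - (q + e)))))"

lemma threshold_mono: "n \<le> n' \<Longrightarrow> threshold e q n y \<le> threshold e q n' y"
  unfolding threshold_def by (intro max.mono min.mono add_mono order_refl)

lemma threshold_Suc_le: "threshold e q (Suc n) y \<le> Suc (threshold e q n y)"
proof -
  have "max (Suc n) (min y (q + max (Suc n) k)) \<le> Suc (max n (min y (q + max n k)))" for k
    by (simp add: max_def min_def)
  then show ?thesis
    unfolding threshold_def .
qed

lemma threshold_zero_right: "threshold e q n 0 = n"
  by (simp add: threshold_def)

lemma threshold_1: "y > 0 \<Longrightarrow> threshold e q 1 y = threshold e q 0 y"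
  by (auto simp: threshold_def)

lemma threshold_pos: "y > 0 \<Longrightarrow> threshold e q n y \<ge> 1"
  by (auto simp: threshold_def)

lemma threshold_eq_left: "y \<le> n \<Longrightarrow> threshold e q n y = n"
  by (auto simp: threshold_def)

lemma threshold_le: "y < m \<Longrightarrow> n \<le> m \<Longrightarrow> threshold e q n y \<le> m"
  by (auto simp: threshold_def)

lemma threshold_Suc_right: "q \<ge> 1 \<Longrightarrow> threshold e q n (Suc n) = Suc n"
  by (auto simp: threshold_def)

locale semigroup_params =
  fixes e q d m :: nat
  assumes e_ge: "e \<ge> 4" and q_ge: "q \<ge> 1" and d_ge: "d \<ge> 1"
    and m_def: "m = e + 2 * q + 1" and coprime_md: "coprime m d"
begin

lemma m_pos: "m > 0"
  by (simp add: m_def)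

lemma gens_cases:
  assumes "g \<in> gens e q d"
  obtains "g = 1 * m + 0 * d" | "g = 1 * m + 1 * d"
  | i where "2 \<le> i" "i \<le> e - 1" "g = (q + 1) * m + (q + i) * d"
  using assms by (auto simp: gens_def Let_def m_def)

lemma gens_intros:
  "m \<in> gens e q d" "m + d \<in> gens e q d"
  "2 \<le> i \<Longrightarrow> i \<le> e - 1 \<Longrightarrow> (q + 1) * m + (q + i) * d \<in> gens e q d"
  by (auto simp: gens_def Let_def m_def)

lemma zero_notin_gens: "0 \<notin> gens e q d"
  by (auto simp: gens_def Let_def)

text \<open>
  The three alternatives are: no big generator, exactly one, at least two.  Here \<open>y\<close> is not
  reduced modulo \<open>m\<close>.
\<close>

lemma coordinates_of_gens_sum:
  assumes "xs \<in> lists (gens e q d)"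
  obtains x y where "sum_list xs = x * m + y * d"
    and "x = length xs \<and> y \<le> length xs
       \<or> x = length xs + q \<and> 1 \<le> length xs \<and> y + 2 \<le> length xs + q + e
       \<or> length xs + 2 * q \<le> x \<and> 2 \<le> length xs"
proof -
  define P where "P N x y \<longleftrightarrow> x = N \<and> y \<le> N
       \<or> x = N + q \<and> 1 \<le> N \<and> y + 2 \<le> N + q + e
       \<or> N + 2 * q \<le> x \<and> 2 \<le> N" for N x y
  have "\<exists>x y. sum_list xs = x * m + y * d \<and> P (length xs) x y"
    using assms
  proof (induction rule: lists.induct)
    case Nil
    have "P 0 0 0" by (simp add: P_def)
    then show ?case by force
  next
    case (Cons g xs)
    then obtain x y where xy: "sum_list xs = x * m + y * d" "P (length xs) x y"
      by auto
    have "g \<in> gens e q d" using Cons.hyps by simp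
    then obtain u v where uv: "g = u * m + v * d" "P (Suc (length xs)) (u + x) (v + y)"
    proof (cases rule: gens_cases)
      case 1
      moreover have "P (Suc (length xs)) (1 + x) (0 + y)"
        using xy(2) by (auto simp: P_def)
      ultimately show ?thesis using that by blast
    next
      case 2
      moreover have "P (Suc (length xs)) (1 + x) (1 + y)"
        using xy(2) by (auto simp: P_def)
      ultimately show ?thesis using that by blast
    next
      case (3 i)
      moreover have "P (Suc (length xs)) (q + 1 + x) (q + i + y)"
        using xy(2) 3(1,2) by (auto simp: P_def)
      ultimately show ?thesis using that by blast
    qed
    have "sum_list (g # xs) = (u + x) * m + (v + y) * d"
      using xy(1) uv(1) by (simp add: algebra_simps)
    with uv(2) show ?case by auto
  qed
  then show thesis using that unfolding P_def by blast
qed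

text \<open>
  Reducing \<open>y\<close> modulo \<open>m\<close> only increases \<open>x\<close>, because \<open>m * d\<close> is \<open>d\<close> copies of \<open>m\<close>.  With two or
  more big generators the bound holds since \<open>y < m\<close> forces \<open>y + 2 - (q + e) \<le> q + 2\<close>.
\<close>

lemma gens_sum_above_threshold:
  assumes "xs \<in> lists (gens e q d)"
  obtains x y where "sum_list xs = x * m + y * d" "y < m" "threshold e q (length xs) y \<le> x"
proof -
  obtain x y where s: "sum_list xs = x * m + y * d"
    and c: "x = length xs \<and> y \<le> length xs
       \<or> x = length xs + q \<and> 1 \<le> length xs \<and> y + 2 \<le> length xs + q + e
       \<or> length xs + 2 * q \<le> x \<and> 2 \<le> length xs"
    using coordinates_of_gens_sum[OF assms] by blast
  define y' where "y' = y mod m"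
  have y': "y' < m" "y' \<le> y" using m_pos by (auto simp: y'_def)
  have "threshold e q (length xs) y' \<le> x"
    using c y' by (auto simp: threshold_def m_def)
  then have "threshold e q (length xs) y' \<le> x + (y div m) * d"
    by simp
  moreover have "sum_list xs = (x + (y div m) * d) * m + y' * d"
  proof -
    have "y * d = (y div m * m + y') * d" by (simp add: y'_def)
    then show ?thesis using s by (simp add: algebra_simps)
  qed
  ultimately show thesis using that y'(1) by blast
qed

text \<open>
  If \<open>x \<ge> y\<close>, the sum of \<open>x - y\<close> copies of \<open>m\<close> and \<open>y\<close> copies of \<open>m + d\<close> does it.  Otherwise one
  big generator is used, together with \<open>x - q - 1\<close> small ones, of which as many as possible are
  equal to \<open>m + d\<close>.
\<close>

lemma above_threshold_in_long_sums:
  assumes "y < m" and "threshold e q n y \<le> x"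
  shows "x * m + y * d \<in> long_sums (gens e q d) n"
proof (cases "y \<le> x")
  case True
  then obtain a where a: "x = y + a" by (auto simp: le_iff_add)
  let ?xs = "replicate a m @ replicate y (m + d)"
  have "sum_list ?xs = x * m + y * d"
    by (simp add: sum_list_replicate a algebra_simps)
  moreover have "?xs \<in> lists (gens e q d)"
    using gens_intros by (auto simp: in_lists_conv_set)
  moreover have "n \<le> length ?xs"
    using True assms a by (simp add: threshold_def)
  ultimately show ?thesis unfolding long_sums_def by (metis (mono_tags, lifting) mem_Collect_eq)
next
  case False
  then have bounds: "q + n \<le> x" "q + 1 \<le> x" "y + 2 \<le> x + e"
    using assms(2) by (auto simp: threshold_def)
  define b where "b = min (x - q - 1) (y - q - 2)"
  define i where "i = y - q - b"
  define a where "a = x - q - 1 - b"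
  have i: "2 \<le> i" "i \<le> e - 1" and sums: "x = a + b + (q + 1)" "y = b + (q + i)"
    using bounds False by (auto simp: b_def i_def a_def)
  let ?xs = "((q + 1) * m + (q + i) * d) # replicate a m @ replicate b (m + d)"
  have "sum_list ?xs = x * m + y * d"
    by (simp add: sum_list_replicate sums algebra_simps)
  moreover have "?xs \<in> lists (gens e q d)"
    using gens_intros(1,2) gens_intros(3)[OF i] by (auto simp: in_lists_conv_set)
  moreover have "n \<le> length ?xs"
    using bounds sums by simp
  ultimately show ?thesis unfolding long_sums_def by (metis (mono_tags, lifting) mem_Collect_eq)
qed

theorem sums_of_many_gens:
  "long_sums (gens e q d) n = {x * m + y * d | x y. y < m \<and> threshold e q n y \<le> x}"
proof (intro equalityI subsetI)
  fix s assume "s \<in> long_sums (gens e q d) n"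
  then obtain xs where xs: "s = sum_list xs" "xs \<in> lists (gens e q d)" "n \<le> length xs"
    by (auto simp: long_sums_def)
  obtain x y where "sum_list xs = x * m + y * d" "y < m" "threshold e q (length xs) y \<le> x"
    using gens_sum_above_threshold[OF xs(2)] .
  then show "s \<in> {x * m + y * d | x y. y < m \<and> threshold e q n y \<le> x}"
    using xs threshold_mono[OF xs(3), of e q y] by force
qed (use above_threshold_in_long_sums in blast)

lemma mem_long_sums_iff:
  assumes "y < m"
  shows "x * m + y * d \<in> long_sums (gens e q d) n \<longleftrightarrow> threshold e q n y \<le> x"
  using coordinates_unique[OF coprime_md assms] assms unfolding sums_of_many_gens by blast

section \<open>The semigroup, its Apery set and its reduction number\<close>

abbreviation "\<Gamma> \<equiv> semigroup_generated (gens e q d)"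

lemma fold_max_ideal_\<Gamma>: "n \<ge> 1 \<Longrightarrow> fold_max_ideal n \<Gamma> = long_sums (gens e q d) n"
  using fold_max_ideal_eq_long_sums[OF zero_notin_gens] .

lemma mem_\<Gamma>_iff: "y < m \<Longrightarrow> x * m + y * d \<in> \<Gamma> \<longleftrightarrow> threshold e q 0 y \<le> x"
  using mem_long_sums_iff[of y x 0] by (simp add: long_sums_0)

lemma \<Gamma>_cases:
  assumes "s \<in> \<Gamma>"
  obtains x y where "s = x * m + y * d" "y < m" "threshold e q 0 y \<le> x"
  using assms sums_of_many_gens[of 0] by (auto simp: long_sums_0)

lemma numerical_semigroup_\<Gamma>: "numerical_semigroup \<Gamma>"
  unfolding numerical_semigroup_def
proof (intro conjI ballI)
  show "0 \<in> \<Gamma>"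
    using mem_\<Gamma>_iff[of 0 0] m_pos by (simp add: threshold_zero_right)
  show "x + y \<in> \<Gamma>" if "x \<in> \<Gamma>" "y \<in> \<Gamma>" for x y
  proof -
    obtain xs ys where "x + y = sum_list (xs @ ys)" "xs @ ys \<in> lists (gens e q d)"
      using \<open>x \<in> \<Gamma>\<close> \<open>y \<in> \<Gamma>\<close> by (fastforce simp: semigroup_generated_def)
    then show ?thesis
      unfolding semigroup_generated_def by (metis image_eqI)
  qed
  have "s \<in> \<Gamma>" if "s \<ge> m * m + m * d" for s
  proof -
    obtain x y where "s = x * m + y * d" "y < m" "x \<ge> m"
      using coordinates_exist[OF coprime_md m_pos \<open>s \<ge> m * m + m * d\<close>] .
    then show ?thesis
      using mem_\<Gamma>_iff[of y x] threshold_le[of y m 0 e q] by simp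
  qed
  then have "- \<Gamma> \<subseteq> {..<m * m + m * d}"
    by (force simp: not_le[symmetric])
  then show "finite (- \<Gamma>)"
    using finite_subset by blast
qed

lemma multiplicity_\<Gamma>: "multiplicity_of \<Gamma> = m"
  unfolding multiplicity_of_def
proof (rule Least_equality)
  show "m \<in> \<Gamma> \<and> 0 < m"
    using mem_\<Gamma>_iff[of 0 1] m_pos by (simp add: threshold_zero_right)
  show "m \<le> s" if s: "s \<in> \<Gamma> \<and> 0 < s" for s
  proof -
    obtain x y where xy: "s = x * m + y * d" "threshold e q 0 y \<le> x"
      using s \<Gamma>_cases by blast
    have "x \<ge> 1"
      using s xy threshold_pos[of y e q 0] by (cases "y = 0"; cases "x = 0") auto
    then show ?thesis
      using xy(1) by (cases x) auto
  qed
qed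

lemma apery_set_\<Gamma>: "apery_set \<Gamma> m = (\<lambda>y. threshold e q 0 y * m + y * d) ` {..<m}"
proof (intro equalityI subsetI)
  fix s assume s: "s \<in> apery_set \<Gamma> m"
  then have "s \<in> \<Gamma>" by (simp add: apery_set_def)
  then obtain x y where xy: "s = x * m + y * d" "y < m" "threshold e q 0 y \<le> x"
    by (rule \<Gamma>_cases)
  have "\<not> threshold e q 0 y < x"
  proof
    assume less: "threshold e q 0 y < x"
    then obtain x' where x': "x = Suc x'" by (cases x) auto
    have "x' * m + y * d \<in> \<Gamma>"
      using less x' mem_\<Gamma>_iff[OF xy(2)] by simp
    moreover have "int s - int m = int (x' * m + y * d)"
      using xy(1) x' by simp
    ultimately show False
      using s unfolding apery_set_def by blast
  qed
  then show "s \<in> (\<lambda>y. threshold e q 0 y * m + y * d) ` {..<m}"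
    using xy by auto
next
  fix s assume "s \<in> (\<lambda>y. threshold e q 0 y * m + y * d) ` {..<m}"
  then obtain y where y: "y < m" and s: "s = threshold e q 0 y * m + y * d" by auto
  have "int s - int m \<notin> int ` \<Gamma>"
  proof
    assume "int s - int m \<in> int ` \<Gamma>"
    then obtain t where t: "t \<in> \<Gamma>" "s = t + m" by auto
    then obtain x' y' where xy': "t = x' * m + y' * d" "y' < m" "threshold e q 0 y' \<le> x'"
      using \<Gamma>_cases by blast
    have "threshold e q 0 y * m + y * d = Suc x' * m + y' * d"
      using s t(2) xy'(1) by simp
    then have "threshold e q 0 y = Suc x' \<and> y = y'"
      by (rule coordinates_unique[OF coprime_md y xy'(2)])
    then show False using xy'(3) by auto
  qed
  then show "s \<in> apery_set \<Gamma> m"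
    using y s mem_\<Gamma>_iff[OF y] by (simp add: apery_set_def)
qed

lemma reduction_number_\<Gamma>: "reduction_number \<Gamma> m = m - 1"
  unfolding reduction_number_def
proof (rule Least_equality)
  \<comment> \<open>From row \<open>m - 1\<close> on, the threshold in row \<open>n\<close> is \<open>n\<close> in every class.\<close>
  have full: "long_sums (gens e q d) n = {x * m + y * d | x y. y < m \<and> n \<le> x}" if "m - 1 \<le> n" for n
  proof -
    have "threshold e q n y = n" if "y < m" for y
      using \<open>m - 1 \<le> n\<close> that by (intro threshold_eq_left) simp
    then show ?thesis unfolding sums_of_many_gens by (metis (no_types, lifting))
  qed
  have "long_sums (gens e q d) m = m +o long_sums (gens e q d) (m - 1)"
  proof (intro equalityI subsetI)
    fix s assume "s \<in> long_sums (gens e q d) m"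
    then obtain x y where xy: "s = x * m + y * d" "y < m" "m \<le> x"
      by (auto simp: full)
    then obtain x' where x': "x = Suc x'"
      using m_pos by (cases x) auto
    then have "s = m + (x' * m + y * d)" "m - 1 \<le> x'"
      using xy by auto
    then have "s = m + (x' * m + y * d)" "x' * m + y * d \<in> long_sums (gens e q d) (m - 1)"
      using xy(2) full[of "m - 1"] by blast+
    then show "s \<in> m +o long_sums (gens e q d) (m - 1)"
      by (simp add: elt_set_plus_def)
  next
    fix s assume "s \<in> m +o long_sums (gens e q d) (m - 1)"
    then obtain x y where xy: "s = m + (x * m + y * d)" "y < m" "m - 1 \<le> x"
      by (auto simp: full elt_set_plus_def)
    then have "s = Suc x * m + y * d" "m \<le> Suc x"
      by auto
    then show "s \<in> long_sums (gens e q d) m"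
      using xy(2) by (auto simp only: full diff_le_self)
  qed
  then show "fold_max_ideal (m - 1 + 1) \<Gamma> = m +o fold_max_ideal (m - 1) \<Gamma>"
    using e_ge m_def by (simp add: fold_max_ideal_\<Gamma>)
next
  fix r assume eq: "fold_max_ideal (r + 1) \<Gamma> = m +o fold_max_ideal r \<Gamma>"
  show "m - 1 \<le> r"
  proof (rule ccontr)
    assume "\<not> m - 1 \<le> r"
    then have r: "r + 1 < m" by simp
    \<comment> \<open>The witness is the sum of \<open>r + 1\<close> copies of \<open>m + d\<close>: for \<open>r \<ge> 1\<close> it is the least
        element of its residue class already in \<open>rM\<close>, so subtracting \<open>m\<close> leads out of \<open>rM\<close>;
        for \<open>r = 0\<close> subtracting \<open>m\<close> leaves \<open>d\<close>, which is not in \<open>0M = {0}\<close>.\<close>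
    let ?s = "(r + 1) * m + (r + 1) * d"
    have "?s \<in> fold_max_ideal (r + 1) \<Gamma>"
      using mem_long_sums_iff[OF r, of "r + 1" "r + 1"]
      by (simp add: fold_max_ideal_\<Gamma> threshold_eq_left)
    then have "?s \<in> m +o fold_max_ideal r \<Gamma>"
      unfolding eq .
    then have mem: "r * m + (r + 1) * d \<in> fold_max_ideal r \<Gamma>"
      by (auto simp: elt_set_plus_def algebra_simps)
    show False
    proof (cases "r = 0")
      case True
      then show False
        using mem d_ge by (simp add: fold_max_ideal_def)
    next
      case False
      then show False
        using mem mem_long_sums_iff[OF r, of r r] threshold_Suc_right[OF q_ge, of e r]
        by (simp add: fold_max_ideal_\<Gamma>)
    qed
  qed
qed

section \<open>The Apery table\<close>

text \<open>
  The hypothesis \<open>y = 0 \<longleftrightarrow> i = 0\<close> matches the exceptional first step of the recursion: the class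
  of 0 is the only one whose threshold moves from row 0 to row 1.
\<close>

lemma apery_entry_\<Gamma>:
  assumes "i < m" and "\<omega> i = threshold e q 0 y * m + y * d" and "y < m" and "y = 0 \<longleftrightarrow> i = 0"
  shows "apery_entry \<Gamma> m \<omega> n i = threshold e q n y * m + y * d"
proof (induction n rule: induct_nat_012)
  case 0
  show ?case using assms by simp
next
  case 1
  show ?case
    using assms threshold_1[of y e q] by (auto simp: threshold_zero_right)
next
  case (ge2 n)
  have "threshold e q (Suc n) y \<le> threshold e q (Suc (Suc n)) y"
    by (simp add: threshold_mono)
  moreover have "threshold e q (Suc (Suc n)) y \<le> Suc (threshold e q (Suc n) y)"
    by (rule threshold_Suc_le)
  ultimately consider "threshold e q (Suc (Suc n)) y = threshold e q (Suc n) y"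
    | "threshold e q (Suc (Suc n)) y = Suc (threshold e q (Suc n) y)"
    by linarith
  then show ?case
    using ge2.IH(2) mem_long_sums_iff[OF assms(3)]
    by cases (simp_all add: fold_max_ideal_\<Gamma>)
qed

text \<open>
  The second coordinate of the column with index \<open>i\<close>, counted from 0: the first block covers
  \<open>0, \<dots>, q + 1\<close>, the second block covers \<open>q + e - 1, \<dots>, m - 1\<close>, and the third block fills the
  gap between them.
\<close>

definition column :: "nat \<Rightarrow> nat" where
  "column i = (if i < q + 2 then i else if i < 2 * q + 4 then i + e - 3 else i - q - 2)"

lemma bij_betw_column: "bij_betw column {..<m} {..<m}"
proof (rule bij_betw_byWitness[where
      f' = "\<lambda>y. if y < q + 2 then y else if y < q + e - 1 then y + q + 2 else y + 3 - e"])
qed (use e_ge in \<open>auto simp: column_def m_def split: if_splits\<close>)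

lemma column_less: "i < m \<Longrightarrow> column i < m"
  using bij_betwE[OF bij_betw_column] by simp

lemma column_eq_0_iff: "column i = 0 \<longleftrightarrow> i = 0"
  using e_ge by (auto simp: column_def)

definition table :: "nat mat" where
  "table = append_cols (S1 e q d) (append_cols (S2 e q d) (S3 e q d))"

lemma dim_blocks:
  "dim_row (S1 e q d) = m" "dim_col (S1 e q d) = q + 2"
  "dim_row (S2 e q d) = m" "dim_col (S2 e q d) = q + 2"
  "dim_row (S3 e q d) = m" "dim_col (S3 e q d) = e - 3"
  by (simp_all add: S1_def S2_def S3_def mat1_def Let_def m_def)

lemma table_carrier: "table \<in> carrier_mat m m"
  using e_ge by (auto simp: table_def append_cols_def dim_blocks m_def)

lemma S1_entry:
  assumes "n < m" and "k < q + 2"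
  shows "S1 e q d $$ (n, k) = threshold e q n k * m + k * d"
proof -
  have "S1 e q d $$ (n, k) =
      (if n = 0 then k * (m + d) else if k = 0 then n * m
       else k * (m + d) + (if n < k then 0 else n - k) * m)"
    using assms by (simp add: S1_def mat1_def Let_def m_def)
  also have "\<dots> = max n k * m + k * d"
    by (auto simp: max_def algebra_simps simp flip: add_mult_distrib2)
  also have "max n k = threshold e q n k"
    using assms by (auto simp: threshold_def)
  finally show ?thesis .
qed

lemma S2_entry:
  assumes "n < m" and "k < q + 2"
  shows "S2 e q d $$ (n, k) = threshold e q n (q + e - 1 + k) * m + (q + e - 1 + k) * d"
proof -
  let ?c = "if n \<le> k + 1 then 0 else if n + 2 \<le> e + k then n - k - 1
    else if n < e + q + k then e - 2 else n - q - k - 1"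
  have "S2 e q d $$ (n, k) = k * (m + d) + (q + 1) * m + (q + e - 1) * d + ?c * m"
    using assms e_ge by (auto simp: S2_def mat1_def Let_def m_def)
  also have "\<dots> = (k + (q + 1) + ?c) * m + (q + e - 1 + k) * d"
    by (simp only: add_mult_distrib add_mult_distrib2 ac_simps)
  also have "k + (q + 1) + ?c = threshold e q n (q + e - 1 + k)"
    using e_ge by (auto simp: threshold_def)
  finally show ?thesis .
qed

lemma S3_entry:
  assumes "n < m" and "k < e - 3"
  shows "S3 e q d $$ (n, k) = threshold e q n (q + 2 + k) * m + (q + 2 + k) * d"
proof -
  let ?c = "if n = 0 then 0 else if n \<le> k + 1 then n - 1
    else if n \<le> q + k + 2 then k + 1 else n - q - 1"
  have "S3 e q d $$ (n, k) = (q + 1) * m + (q + 2 + k) * d + ?c * m"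
    using assms e_ge by (auto simp: S3_def mat1_def Let_def m_def)
  also have "\<dots> = (q + 1 + ?c) * m + (q + 2 + k) * d"
    by (simp only: add_mult_distrib add_mult_distrib2 ac_simps)
  also have "q + 1 + ?c = threshold e q n (q + 2 + k)"
    using assms by (auto simp: threshold_def)
  finally show ?thesis .
qed

lemma table_entry:
  assumes "n < m" and "i < m"
  shows "table $$ (n, i) = threshold e q n (column i) * m + column i * d"
proof -
  consider (first) "i < q + 2" | (second) k where "i = q + 2 + k" "k < q + 2"
    | (third) k where "i = 2 * q + 4 + k" "k < e - 3"
  proof -
    have "i < q + 2 \<or> (i = q + 2 + (i - (q + 2)) \<and> i - (q + 2) < q + 2)
        \<or> (i = 2 * q + 4 + (i - (2 * q + 4)) \<and> i - (2 * q + 4) < e - 3)"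
      using assms e_ge unfolding m_def by linarith
    then show thesis using that by blast
  qed
  then show ?thesis
  proof cases
    case first
    then show ?thesis
      using assms by (simp add: table_def append_cols_def dim_blocks S1_entry column_def)
  next
    case (second k)
    then have "column i = q + e - 1 + k"
      using e_ge by (simp add: column_def)
    moreover have "table $$ (n, i) = S2 e q d $$ (n, k)"
      using assms second by (simp add: table_def append_cols_def dim_blocks)
    ultimately show ?thesis
      using assms second by (simp add: S2_entry)
  next
    case (third k)
    then have "column i = q + 2 + k"
      by (simp add: column_def)
    moreover have "table $$ (n, i) = S3 e q d $$ (n, k)"
      using assms third by (simp add: table_def append_cols_def dim_blocks)
    ultimately show ?thesis
      using assms third by (simp add: S3_entry)
  qed
qed

lemma apery_ordering_table: "apery_ordering \<Gamma> m (\<lambda>i. table $$ (0, i))"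
proof -
  let ?w = "\<lambda>y. threshold e q 0 y * m + y * d"
  have "inj_on ?w {..<m}"
    by (intro inj_onI) (use coordinates_unique[OF coprime_md] in blast)
  then have "bij_betw ?w {..<m} (apery_set \<Gamma> m)"
    by (simp add: bij_betw_def apery_set_\<Gamma>)
  then have "bij_betw (?w \<circ> column) {..<m} (apery_set \<Gamma> m)"
    using bij_betw_column bij_betw_trans by blast
  then have "bij_betw (\<lambda>i. table $$ (0, i)) {..<m} (apery_set \<Gamma> m)"
    by (rule bij_betw_cong[THEN iffD1, rotated]) (simp add: table_entry m_pos)
  moreover have "column 0 = 0"
    by (simp add: column_eq_0_iff)
  then have "table $$ (0, 0) = 0"
    using table_entry[of 0 0] m_pos by (simp add: threshold_zero_right)
  ultimately show ?thesis
    by (simp add: apery_ordering_def)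
qed

lemma apery_table_eq_table: "apery_table \<Gamma> m (\<lambda>i. table $$ (0, i)) = table"
proof (rule eq_matI)
  fix n i assume "n < dim_row table" "i < dim_col table"
  then have ni: "n < m" "i < m"
    using table_carrier by auto
  have "apery_table \<Gamma> m (\<lambda>i. table $$ (0, i)) $$ (n, i) =
      apery_entry \<Gamma> m (\<lambda>i. table $$ (0, i)) n i"
    using ni by (simp add: apery_table_def reduction_number_\<Gamma>)
  also have "\<dots> = threshold e q n (column i) * m + column i * d"
    using ni m_pos by (intro apery_entry_\<Gamma>) (simp_all add: table_entry column_less column_eq_0_iff)
  also have "\<dots> = table $$ (n, i)"
    using ni by (simp add: table_entry)
  finally show "apery_table \<Gamma> m (\<lambda>i. table $$ (0, i)) $$ (n, i) = table $$ (n, i)" .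
qed (use table_carrier m_pos in \<open>auto simp: apery_table_def reduction_number_\<Gamma>\<close>)

end

theorem theorem3p3:
  fixes e q d m :: nat and \<Gamma> :: "nat set" and A :: "nat mat"
  assumes "e \<ge> 4" and "q \<ge> 1" and "d \<ge> 1"
    and "m = e + 2 * q + 1"
    and "gcd m d = 1"
    and "\<Gamma> = semigroup_generated (gens e q d)"
    and "A = append_cols (S1 e q d) (append_cols (S2 e q d) (S3 e q d))"
  shows "numerical_semigroup \<Gamma> \<and> multiplicity_of \<Gamma> = m \<and>
         A \<in> carrier_mat m m \<and>
         apery_ordering \<Gamma> m (\<lambda>i. A $$ (0, i)) \<and>
         apery_table \<Gamma> m (\<lambda>i. A $$ (0, i)) = A"
proof -
  interpret semigroup_params e q d m
    using assms by unfold_locales (auto simp: coprime_iff_gcd_eq_1)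
  have "A = table"
    using assms(7) by (simp add: table_def)
  then show ?thesis
    unfolding assms(6)
    using numerical_semigroup_\<Gamma> multiplicity_\<Gamma> table_carrier apery_ordering_table
      apery_table_eq_table
    by blast
qed

end
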